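(* Let $P(7,1)$ be the graph with vertex set $\{u_0,\dots,u_6,v_0,\dots,v_6\}$ and edges $u_iu_{i+1}$, $v_iv_{i+1}$, $u_iv_i$ ($i=0,\dots,6$, indices mod $7$). Up to switching isomorphism there are exactly $27$ different signed graphs on $P(7,1)$; i.e., the set of all signatures $\Sigma\subseteq E(P(7,1))$ falls into exactly $27$ classes under switching isomorphism.
   Context: A signature of a graph $G$ is a subset $\Sigma\subseteq E(G)$ (the negative edges). Resigning at a vertex $v$ replaces $\Sigma$ by its symmetric difference with the set of edges incident with $v$; two signatures are switching equivalent if one is obtained from the other by a sequence of resignings. Two signatures $\Sigma_1,\Sigma_2$ of $G$ are switching isomorphic if there is an automorphism $\psi$ of $G$ such that $\psi(\Sigma_1)=\{\psi(x)\psi(y):xy\in\Sigma_1\}$ is switching equivalent to $\Sigma_2$. *)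

theory Defs
  imports Main
begin

text \<open>
  Undirected graphs: edges are sets of vertices, so that signatures are just sets of
  edges. The digraphs of the \<open>Graph_Theory\<close> entry would represent each
  edge by two opposite arcs.
\<close>

record 'a graph =
  verts :: "'a set"
  edges :: "'a set set"

definition simple_graph :: "'a graph \<Rightarrow> bool" where
  "simple_graph G \<longleftrightarrow> (\<forall>e\<in>edges G. e \<subseteq> verts G \<and> card e = 2)"

definition automorphism :: "'a graph \<Rightarrow> ('a \<Rightarrow> 'a) \<Rightarrow> bool" where
  "automorphism G \<psi> \<longleftrightarrow> bij_betw \<psi> (verts G) (verts G) \<and>
     (\<forall>x\<in>verts G. \<forall>y\<in>verts G. {x, y} \<in> edges G \<longleftrightarrow> {\<psi> x, \<psi> y} \<in> edges G)"

definition signatures :: "'a graph \<Rightarrow> 'a set set set" where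
  "signatures G = Pow (edges G)"

definition incident_edges :: "'a graph \<Rightarrow> 'a \<Rightarrow> 'a set set" where
  "incident_edges G v = {e \<in> edges G. v \<in> e}"

definition resign :: "'a graph \<Rightarrow> 'a \<Rightarrow> 'a set set \<Rightarrow> 'a set set" where
  "resign G v S = sym_diff S (incident_edges G v)"

definition switching_equivalent :: "'a graph \<Rightarrow> 'a set set \<Rightarrow> 'a set set \<Rightarrow> bool" where
  "switching_equivalent G = (\<lambda>S T. \<exists>v\<in>verts G. T = resign G v S)\<^sup>*\<^sup>*"

definition switching_isomorphic :: "'a graph \<Rightarrow> 'a set set \<Rightarrow> 'a set set \<Rightarrow> bool" where
  "switching_isomorphic G S T \<longleftrightarrow>
     (\<exists>\<psi>. automorphism G \<psi> \<and> switching_equivalent G ((`) \<psi> ` S) T)"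

definition switching_isomorphism_rel :: "'a graph \<Rightarrow> ('a set set \<times> 'a set set) set" where
  "switching_isomorphism_rel G =
     {(S, T). S \<in> signatures G \<and> T \<in> signatures G \<and> switching_isomorphic G S T}"

text \<open>
  The generalized Petersen graph \<open>P(n, k)\<close>; the theorem concerns \<open>n = 7\<close>, \<open>k = 1\<close>,
  i.e. the heptagonal prism.
\<close>

datatype pvertex = U nat | V nat

definition petersen :: "nat \<Rightarrow> nat \<Rightarrow> pvertex graph" where
  "petersen n k =
     \<lparr>verts = U ` {..<n} \<union> V ` {..<n},
      edges = (\<Union>i<n. {{U i, U ((i + 1) mod n)}, {V i, V ((i + k) mod n)}, {U i, V i}})\<rparr>"

lemma simple_graph_petersen_7_1: "simple_graph (petersen 7 1)"
proof -
  have "i < 7 \<Longrightarrow> i \<noteq> Suc i mod 7" for i :: nat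
    by presburger
  then have "card {U i, U (Suc i mod 7)} = 2" "card {V i, V (Suc i mod 7)} = 2" if "i < 7" for i
    using that by simp_all
  then show ?thesis
    by (auto simp: simple_graph_def petersen_def)
qed

lemma automorphism_bij: "automorphism G \<psi> \<Longrightarrow> bij_betw \<psi> (verts G) (verts G)"
  unfolding automorphism_def by (rule conjunct1)

lemma automorphism_vert: "automorphism G \<psi> \<Longrightarrow> x \<in> verts G \<Longrightarrow> \<psi> x \<in> verts G"
  using automorphism_bij bij_betwE by metis

lemma automorphism_edge:
  assumes "automorphism G \<psi>" "x \<in> verts G" "y \<in> verts G"
  shows "{x, y} \<in> edges G \<longleftrightarrow> {\<psi> x, \<psi> y} \<in> edges G"
  using assms unfolding automorphism_def by blast

lemma automorphism_image_edge:
  assumes "simple_graph G" "automorphism G \<psi>" "e \<in> edges G"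
  shows "\<psi> ` e \<in> edges G"
proof -
  obtain x y where e: "e = {x, y}" using assms(1,3) by (auto simp: simple_graph_def card_2_iff)
  then have "x \<in> verts G" "y \<in> verts G" using assms(1,3) by (auto simp: simple_graph_def)
  then show ?thesis using automorphism_edge[OF assms(2)] assms(3) e by auto
qed

lemma automorphism_id: "automorphism G id"
  by (simp add: automorphism_def)

lemma automorphism_comp:
  assumes "automorphism G \<psi>" "automorphism G \<phi>"
  shows "automorphism G (\<phi> \<circ> \<psi>)"
  unfolding automorphism_def
proof (intro conjI ballI)
  show "bij_betw (\<phi> \<circ> \<psi>) (verts G) (verts G)"
    using assms automorphism_bij bij_betw_trans by blast
next
  fix x y assume "x \<in> verts G" "y \<in> verts G"
  then show "{x, y} \<in> edges G \<longleftrightarrow> {(\<phi> \<circ> \<psi>) x, (\<phi> \<circ> \<psi>) y} \<in> edges G"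
    unfolding comp_def by (metis assms automorphism_edge automorphism_vert)
qed

lemma automorphism_inv:
  assumes "automorphism G \<psi>"
  shows "automorphism G (inv_into (verts G) \<psi>)"
  unfolding automorphism_def
proof (intro conjI ballI)
  show "bij_betw (inv_into (verts G) \<psi>) (verts G) (verts G)"
    using automorphism_bij[OF assms] by (rule bij_betw_inv_into)
next
  let ?\<phi> = "inv_into (verts G) \<psi>"
  have inv: "?\<phi> x \<in> verts G" "\<psi> (?\<phi> x) = x" if "x \<in> verts G" for x
    using that automorphism_bij[OF assms] by (auto simp: bij_betw_def inv_into_into f_inv_into_f)
  fix x y assume "x \<in> verts G" "y \<in> verts G"
  then show "{x, y} \<in> edges G \<longleftrightarrow> {?\<phi> x, ?\<phi> y} \<in> edges G"
    using automorphism_edge[OF assms, of "?\<phi> x" "?\<phi> y"] inv by simp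
qed

lemma automorphism_image_resign:
  assumes G: "simple_graph G" and \<psi>: "automorphism G \<psi>"
    and v: "v \<in> verts G" and S: "S \<subseteq> edges G"
  shows "(`) \<psi> ` resign G v S = resign G (\<psi> v) ((`) \<psi> ` S)"
proof -
  have b: "bij_betw \<psi> (verts G) (verts G)" using \<psi> by (rule automorphism_bij)
  have sub: "edges G \<subseteq> Pow (verts G)" using G by (auto simp: simple_graph_def)
  have inj: "inj_on ((`) \<psi>) (edges G)"
    using b sub by (meson bij_betw_def inj_on_image_Pow inj_on_subset)
  have inc: "(`) \<psi> ` incident_edges G v = incident_edges G (\<psi> v)"
  proof (intro equalityI subsetI)
    fix e assume "e \<in> (`) \<psi> ` incident_edges G v"
    then show "e \<in> incident_edges G (\<psi> v)"
      using automorphism_image_edge[OF G \<psi>] by (auto simp: incident_edges_def)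
  next
    fix e assume e: "e \<in> incident_edges G (\<psi> v)"
    let ?f = "inv_into (verts G) \<psi> ` e"
    have ev: "e \<subseteq> verts G" using e sub by (auto simp: incident_edges_def)
    have "?f \<in> edges G"
      using automorphism_image_edge[OF G automorphism_inv[OF \<psi>]] e
      by (simp add: incident_edges_def)
    moreover have "v \<in> ?f"
    proof -
      have "inv_into (verts G) \<psi> (\<psi> v) = v" using v b by (simp add: bij_betw_def)
      moreover have "\<psi> v \<in> e" using e by (simp add: incident_edges_def)
      ultimately show ?thesis by (metis imageI)
    qed
    moreover have "\<psi> ` ?f = e"
      using ev b by (simp add: image_inv_into_cancel bij_betw_def)
    ultimately show "e \<in> (`) \<psi> ` incident_edges G v"
      unfolding incident_edges_def by (metis (mono_tags, lifting) imageI mem_Collect_eq)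
  qed
  have "incident_edges G v \<subseteq> edges G" by (auto simp: incident_edges_def)
  then have diff: "S - incident_edges G v \<subseteq> edges G" "incident_edges G v - S \<subseteq> edges G"
    and sub': "incident_edges G v \<subseteq> edges G"
    using S by auto
  have "(`) \<psi> ` (S - incident_edges G v) = (`) \<psi> ` S - (`) \<psi> ` incident_edges G v"
    and "(`) \<psi> ` (incident_edges G v - S) = (`) \<psi> ` incident_edges G v - (`) \<psi> ` S"
    by (rule inj_on_image_set_diff[OF inj diff(1) sub'] inj_on_image_set_diff[OF inj diff(2) S])+
  then show ?thesis by (simp add: resign_def image_Un inc)
qed

lemma switching_equivalent_signature:
  assumes "switching_equivalent G S T" "S \<subseteq> edges G"
  shows "T \<subseteq> edges G"
  using assms unfolding switching_equivalent_def
proof (induction rule: rtranclp_induct)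
  case (step T T')
  then show ?case unfolding resign_def incident_edges_def by blast
qed

lemma resign_resign: "resign G v (resign G v S) = S"
  unfolding resign_def by blast

lemma switching_equivalent_sym:
  assumes "switching_equivalent G S T"
  shows "switching_equivalent G T S"
proof -
  have "symp (\<lambda>S T. \<exists>v\<in>verts G. T = resign G v S)"
    by (rule sympI) (metis resign_resign)
  then show ?thesis
    using assms unfolding switching_equivalent_def by (rule sympD[OF symp_rtranclp])
qed

lemma switching_equivalent_image:
  assumes "simple_graph G" "automorphism G \<psi>" "S \<subseteq> edges G" "switching_equivalent G S T"
  shows "switching_equivalent G ((`) \<psi> ` S) ((`) \<psi> ` T)"
  using assms(4) unfolding switching_equivalent_def
proof (induction rule: rtranclp_induct)
  case (step T T')
  then obtain v where v: "v \<in> verts G" "T' = resign G v T" by auto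
  have "T \<subseteq> edges G"
    using step.hyps(1) assms(3) switching_equivalent_signature
    unfolding switching_equivalent_def by blast
  then have "(`) \<psi> ` T' = resign G (\<psi> v) ((`) \<psi> ` T)"
    using automorphism_image_resign[OF assms(1,2) v(1)] v(2) by simp
  moreover have "\<psi> v \<in> verts G"
    using v assms(2) by (simp add: automorphism_vert)
  ultimately show ?case
    by (intro rtranclp.rtrancl_into_rtrancl[OF step.IH] bexI)
qed simp

lemma equiv_switching_isomorphism_rel:
  assumes G: "simple_graph G"
  shows "equiv (signatures G) (switching_isomorphism_rel G)"
proof (rule equivI)
  show "switching_isomorphism_rel G \<subseteq> signatures G \<times> signatures G"
    by (auto simp: switching_isomorphism_rel_def)
  show "refl_on (signatures G) (switching_isomorphism_rel G)"
  proof (rule refl_onI)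
    fix S assume "S \<in> signatures G"
    moreover have "switching_isomorphic G S S"
      unfolding switching_isomorphic_def switching_equivalent_def
      by (rule exI[of _ id]) (simp add: automorphism_id)
    ultimately show "(S, S) \<in> switching_isomorphism_rel G"
      by (simp add: switching_isomorphism_rel_def)
  qed
  show "sym (switching_isomorphism_rel G)"
  proof (rule symI)
    fix S T assume "(S, T) \<in> switching_isomorphism_rel G"
    then obtain \<psi> where S: "S \<subseteq> edges G" and T: "T \<subseteq> edges G" and \<psi>: "automorphism G \<psi>"
      and eq: "switching_equivalent G ((`) \<psi> ` S) T"
      by (auto simp: switching_isomorphism_rel_def switching_isomorphic_def signatures_def)
    let ?\<phi> = "inv_into (verts G) \<psi>"
    have "?\<phi> ` \<psi> ` e = e" if "e \<in> S" for e
    proof -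
      have "e \<subseteq> verts G" using that S G by (auto simp: simple_graph_def)
      then show ?thesis
        using automorphism_bij[OF \<psi>] by (simp add: bij_betw_def)
    qed
    then have "(`) ?\<phi> ` (`) \<psi> ` S = S" by (force simp: image_image)
    then have "switching_equivalent G ((`) ?\<phi> ` T) S"
      using switching_equivalent_image[OF G automorphism_inv[OF \<psi>] T switching_equivalent_sym[OF eq]]
      by simp
    then show "(T, S) \<in> switching_isomorphism_rel G"
      using S T automorphism_inv[OF \<psi>]
      by (auto simp: switching_isomorphism_rel_def switching_isomorphic_def signatures_def)
  qed
  show "trans (switching_isomorphism_rel G)"
  proof (rule transI)
    fix R S T
    assume "(R, S) \<in> switching_isomorphism_rel G" "(S, T) \<in> switching_isomorphism_rel G"
    then obtain \<psi> \<phi> where sub: "R \<subseteq> edges G" "T \<subseteq> edges G"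
      and \<psi>: "automorphism G \<psi>" "switching_equivalent G ((`) \<psi> ` R) S"
      and \<phi>: "automorphism G \<phi>" "switching_equivalent G ((`) \<phi> ` S) T"
      by (auto simp: switching_isomorphism_rel_def switching_isomorphic_def signatures_def)
    have "(`) \<psi> ` R \<subseteq> edges G" using sub automorphism_image_edge[OF G \<psi>(1)] by auto
    then have "switching_equivalent G ((`) \<phi> ` (`) \<psi> ` R) ((`) \<phi> ` S)"
      using switching_equivalent_image[OF G \<phi>(1)] \<psi>(2) by blast
    then have "switching_equivalent G ((`) (\<phi> \<circ> \<psi>) ` R) T"
      using \<phi>(2) unfolding switching_equivalent_def by (simp add: image_image image_comp)
    then show "(R, T) \<in> switching_isomorphism_rel G"
      using sub automorphism_comp[OF \<psi>(1) \<phi>(1)]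
      by (auto simp: switching_isomorphism_rel_def switching_isomorphic_def signatures_def)
  qed
qed

end

theory Submission
  imports Defs
begin

text \<open>
  The cycle space of the prism is spanned by the seven square faces and one rim, and resigning
  preserves the parity of the number of negative edges on every cycle. So a switching class is
  given by a binary necklace of seven face signs together with the sign of the outer rim; the
  sign of the inner rim is their sum. Spokes are the only edges lying on two 4-cycles, so
  automorphisms preserve them, and hence act as a dihedral symmetry of the necklace, possibly
  exchanging the two rims. The exchange changes the rim sign exactly when the number of negative
  faces is odd. There are 18 bracelets of length 7, nine of even weight and nine of odd weight,
  which gives 2 * 9 + 9 = 27 classes.
\<close>

section \<open>Parity of negative edges\<close>

definition negative :: "'a set set \<Rightarrow> 'a set set \<Rightarrow> bool" where
  "negative S C \<longleftrightarrow> odd (card (S \<inter> C))"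

lemma negative_empty [simp]: "\<not> negative S {}"
  by (simp add: negative_def)

lemma negative_insert:
  assumes "finite C" "e \<notin> C"
  shows "negative S (insert e C) \<longleftrightarrow> (e \<in> S) \<noteq> negative S C"
  using assms by (cases "e \<in> S") (auto simp: negative_def)

text \<open>Parity is additive over GF(2): each edge of \<open>C\<close> contributes the exclusive
  or of its two memberships.\<close>

lemma negative_sym_diff:
  assumes "finite C"
  shows "negative (sym_diff S T) C \<longleftrightarrow> negative S C \<noteq> negative T C"
  using assms
proof (induction C rule: finite_induct)
  case (insert e C)
  then show ?case by (simp only: negative_insert[OF insert.hyps]) blast
qed simp

text \<open>The degree condition makes \<open>C\<close> an element of the cycle space. Resigning at
  a vertex flips the edges of \<open>C\<close> there, an even number of them.\<close>

lemma negative_switching_equivalent: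
  assumes C: "finite C" "C \<subseteq> edges G"
    and deg: "\<And>v. v \<in> verts G \<Longrightarrow> even (card {e \<in> C. v \<in> e})"
    and "switching_equivalent G S T"
  shows "negative T C \<longleftrightarrow> negative S C"
  using assms(4) unfolding switching_equivalent_def
proof (induction rule: rtranclp_induct)
  case (step T T')
  then obtain v where v: "v \<in> verts G" "T' = resign G v T" by auto
  have "incident_edges G v \<inter> C = {e \<in> C. v \<in> e}"
    using C(2) by (auto simp: incident_edges_def)
  then have "\<not> negative (incident_edges G v) C"
    using deg[OF v(1)] by (simp add: negative_def)
  then show ?case
    using step.IH C(1) by (simp add: v(2) resign_def negative_sym_diff)
qed simp

text \<open>An automorphism is injective on edges, so it carries \<open>S \<inter> C\<close>
  bijectively onto the intersection of the images.\<close>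

lemma negative_image:
  assumes G: "simple_graph G" "automorphism G \<psi>" and sub: "S \<subseteq> edges G" "C \<subseteq> edges G"
  shows "negative ((`) \<psi> ` S) ((`) \<psi> ` C) \<longleftrightarrow> negative S C"
proof -
  have "edges G \<subseteq> Pow (verts G)" using G(1) by (auto simp: simple_graph_def)
  then have inj: "inj_on ((`) \<psi>) (edges G)"
    using automorphism_bij[OF G(2)] by (meson bij_betw_def inj_on_image_Pow inj_on_subset)
  have "card ((`) \<psi> ` (S \<inter> C)) = card (S \<inter> C)"
    using inj sub by (meson card_image inf.coboundedI1 inj_on_subset)
  then show ?thesis
    by (simp add: negative_def inj_on_image_Int[OF inj sub])
qed

text \<open>Resigning once at every vertex of \<open>X\<close> flips an edge once per end in
  \<open>X\<close>, hence changes exactly the edges of the cut between \<open>X\<close> and its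
  complement.\<close>

lemma switching_equivalent_cut:
  assumes G: "simple_graph G" and X: "finite X" "X \<subseteq> verts G"
    and "S \<subseteq> edges G" "T \<subseteq> edges G"
    and "\<And>x y. {x, y} \<in> edges G \<Longrightarrow> {x, y} \<in> T \<longleftrightarrow> ({x, y} \<in> S) \<noteq> ((x \<in> X) \<noteq> (y \<in> X))"
  shows "switching_equivalent G S T"
  using X assms(4-)
proof (induction X arbitrary: T rule: finite_induct)
  case empty
  have "e \<in> T \<longleftrightarrow> e \<in> S" if "e \<in> edges G" for e
  proof -
    have "card e = 2" using that G by (simp add: simple_graph_def)
    then obtain x y where "e = {x, y}" by (auto simp: card_2_iff)
    then show ?thesis using that empty by auto
  qed
  then have "S = T" using empty by auto
  then show ?case by (simp add: switching_equivalent_def)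
next
  case (insert v X)
  have "switching_equivalent G S (resign G v T)"
  proof (rule insert.IH)
    show "resign G v T \<subseteq> edges G"
      using insert.prems by (auto simp: resign_def incident_edges_def)
    fix x y assume e: "{x, y} \<in> edges G"
    \<comment> \<open>As there are no loops, at most one end of the edge is \<open>v\<close>, so
      resigning at \<open>v\<close> matches adding \<open>v\<close> to the side of the cut.\<close>
    then have "x \<noteq> y" using G by (auto simp: simple_graph_def)
    then show "{x, y} \<in> resign G v T \<longleftrightarrow> ({x, y} \<in> S) \<noteq> ((x \<in> X) \<noteq> (y \<in> X))"
      using insert.prems(4)[OF e] insert.hyps(2) e
      by (auto simp: resign_def incident_edges_def)
  qed (use insert.prems in auto)
  moreover have "T = resign G v (resign G v T)" by (simp add: resign_resign)
  ultimately show ?case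
    using insert.prems(1) unfolding switching_equivalent_def
    by (metis (mono_tags, lifting) insert_subset rtranclp.rtrancl_into_rtrancl)
qed

section \<open>Faces and rims of the heptagonal prism\<close>

definition prism :: "pvertex graph" where
  "prism = petersen 7 1"

lemma simple_graph_prism: "simple_graph prism"
  unfolding prism_def by (rule simple_graph_petersen_7_1)

definition rim_edge :: "(nat \<Rightarrow> pvertex) \<Rightarrow> nat \<Rightarrow> pvertex set" where
  "rim_edge X i = {X i, X (Suc i mod 7)}"

definition spoke :: "nat \<Rightarrow> pvertex set" where
  "spoke i = {U i, V i}"

definition rim :: "(nat \<Rightarrow> pvertex) \<Rightarrow> pvertex set set" where
  "rim X = rim_edge X ` {..<7}"

definition face :: "nat \<Rightarrow> pvertex set set" where
  "face i = {rim_edge U i, rim_edge V i, spoke i, spoke (Suc i mod 7)}"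

lemma verts_prism: "verts prism = U ` {..<7} \<union> V ` {..<7}"
  by (simp add: prism_def petersen_def)

lemma edges_prism: "edges prism = (\<Union>i<7. {rim_edge U i, rim_edge V i, spoke i})"
  by (simp add: prism_def petersen_def rim_edge_def spoke_def)

lemma adjacent_prism:
  "{U i, U j} \<in> edges prism \<longleftrightarrow> i < 7 \<and> j < 7 \<and> (j = Suc i mod 7 \<or> i = Suc j mod 7)"
  "{V i, V j} \<in> edges prism \<longleftrightarrow> i < 7 \<and> j < 7 \<and> (j = Suc i mod 7 \<or> i = Suc j mod 7)"
  "{U i, V j} \<in> edges prism \<longleftrightarrow> i < 7 \<and> j = i"
  "{V j, U i} \<in> edges prism \<longleftrightarrow> i < 7 \<and> j = i"
  by (auto simp: edges_prism rim_edge_def spoke_def doubleton_eq_iff)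

lemma less_7_cases:
  "(i::nat) < 7 \<Longrightarrow> i = 0 \<or> i = 1 \<or> i = 2 \<or> i = 3 \<or> i = 4 \<or> i = 5 \<or> i = 6"
  by arith

text \<open>Adding 6 is subtracting 1 modulo 7; this turns a statement about successors into an
  explicit predecessor.\<close>

lemma eq_Suc_mod_7_iff:
  assumes "i < 7" "j < 7"
  shows "i = Suc j mod 7 \<longleftrightarrow> j = (i + 6) mod 7"
  using less_7_cases[OF assms(1)] less_7_cases[OF assms(2)] by (elim disjE) simp_all

lemma Suc_mod_7_neq: "i < 7 \<Longrightarrow> Suc i mod 7 \<noteq> i" "i < 7 \<Longrightarrow> i \<noteq> Suc i mod 7"
  by presburger+

text \<open>Two indices could share an edge only by being successors of each other, which would
  force 2 = 0 modulo 7.\<close>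

lemma rim_edge_inject:
  assumes "X = U \<or> X = V" "i < 7" "j < 7"
  shows "rim_edge X i = rim_edge X j \<longleftrightarrow> i = j"
proof -
  have "\<not> (i = Suc j mod 7 \<and> Suc i mod 7 = j)" using assms(2,3) by presburger
  then show ?thesis using assms(1) by (auto simp: rim_edge_def doubleton_eq_iff)
qed

lemma rim_edge_distinct [simp]:
  "rim_edge U i \<noteq> rim_edge V j" "rim_edge V i \<noteq> rim_edge U j"
  "rim_edge U i \<noteq> spoke j" "rim_edge V i \<noteq> spoke j"
  "spoke j \<noteq> rim_edge U i" "spoke j \<noteq> rim_edge V i"
  "spoke i = spoke j \<longleftrightarrow> i = j"
  by (auto simp: rim_edge_def spoke_def doubleton_eq_iff)

lemma negative_face:
  assumes "i < 7"
  shows "negative S (face i) \<longleftrightarrow>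
    ((rim_edge U i \<in> S) \<noteq> (rim_edge V i \<in> S)) \<noteq> ((spoke i \<in> S) \<noteq> (spoke (Suc i mod 7) \<in> S))"
  using assms by (auto simp: face_def negative_insert Suc_mod_7_neq)

text \<open>The first \<open>k\<close> rim edges form the path from \<open>X 0\<close> to
  \<open>X k\<close>; the step from 6 to 7 closes it into the whole rim.\<close>

lemma negative_path_Suc:
  assumes "X = U \<or> X = V" "k < 7"
  shows "negative S (rim_edge X ` {..<Suc k}) \<longleftrightarrow>
    (rim_edge X k \<in> S) \<noteq> negative S (rim_edge X ` {..<k})"
proof -
  have "rim_edge X k \<notin> rim_edge X ` {..<k}"
    using assms(2) by (auto simp: rim_edge_inject[OF assms(1)])
  then show ?thesis by (simp add: lessThan_Suc negative_insert)
qed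

lemma rim_eq_path: "rim X = rim_edge X ` {..<Suc 6}"
  by (simp add: rim_def)

text \<open>Each corner of the square meets exactly two of its edges, and every other vertex meets
  none.\<close>

lemma even_degree_face:
  assumes "i < 7"
  shows "even (card {e \<in> face i. v \<in> e})"
proof -
  have "{e \<in> face i. v \<in> e} =
    (if v = U i then {rim_edge U i, spoke i}
     else if v = V i then {rim_edge V i, spoke i}
     else if v = U (Suc i mod 7) then {rim_edge U i, spoke (Suc i mod 7)}
     else if v = V (Suc i mod 7) then {rim_edge V i, spoke (Suc i mod 7)} else {})"
    using Suc_mod_7_neq[OF assms] by (auto simp: face_def rim_edge_def spoke_def)
  then show ?thesis by simp
qed

lemma even_degree_rim:
  assumes X: "X = U \<or> X = V"
  shows "even (card {e \<in> rim X. v \<in> e})"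
proof (cases "v \<in> X ` {..<7}")
  case True
  then obtain j where j: "j < 7" "v = X j" by auto
  let ?k = "(j + 6) mod 7"
  have k: "?k < 7" "?k \<noteq> j" using j(1) by presburger+
  have "v \<in> rim_edge X i \<longleftrightarrow> i = j \<or> i = ?k" if "i < 7" for i
    using that X j(2) eq_Suc_mod_7_iff[OF j(1) that] by (auto simp: rim_edge_def)
  then have "{e \<in> rim X. v \<in> e} = {rim_edge X j, rim_edge X ?k}"
    using j(1) k(1) by (auto simp: rim_def)
  then show ?thesis using rim_edge_inject[OF X k(1) j(1)] k(2) by auto
next
  case False
  have "v \<notin> rim_edge X i" if "i < 7" for i
    using that False by (auto simp: rim_edge_def)
  then have "{e \<in> rim X. v \<in> e} = {}" by (auto simp: rim_def)
  then show ?thesis by (simp only: card.empty even_zero)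
qed

lemma face_subset: "i < 7 \<Longrightarrow> face i \<subseteq> edges prism"
  by (auto simp: face_def edges_prism)

lemma rim_subset: "X = U \<or> X = V \<Longrightarrow> rim X \<subseteq> edges prism"
  by (auto simp: rim_def edges_prism)

lemma finite_rim: "finite (rim X)"
  by (simp add: rim_def)

lemma finite_face: "finite (face i)"
  by (simp add: face_def)

lemma face_rim_switching_equivalent:
  assumes "switching_equivalent prism S T"
  shows "i < 7 \<Longrightarrow> negative T (face i) \<longleftrightarrow> negative S (face i)"
    and "X = U \<or> X = V \<Longrightarrow> negative T (rim X) \<longleftrightarrow> negative S (rim X)"
  by (rule negative_switching_equivalent[OF _ _ _ assms];
      simp add: finite_face face_subset even_degree_face finite_rim rim_subset even_degree_rim)+

section \<open>Face signs and rim sign as a complete switching invariant\<close>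

definition face_signs :: "pvertex set set \<Rightarrow> bool list" where
  "face_signs S = map (\<lambda>i. negative S (face i)) [0..<7]"

lemma length_face_signs [simp]: "length (face_signs S) = 7"
  by (simp add: face_signs_def)

lemma nth_face_signs [simp]: "i < 7 \<Longrightarrow> face_signs S ! i \<longleftrightarrow> negative S (face i)"
  by (simp add: face_signs_def)

text \<open>The sum of all faces in the cycle space is the sum of the two rims, because every spoke
  lies on two faces and cancels.\<close>

lemma negative_rim_V:
  "negative S (rim V) \<longleftrightarrow> negative S (rim U) \<noteq> odd (count_list (face_signs S) True)"
proof -
  \<comment> \<open>The spokes telescope, leaving only the first and the last. The bound stops
    before face 6, whose second spoke wraps around to \<open>spoke 0\<close>; that face is added
    separately and cancels both remaining spokes.\<close>
  have "k \<le> 6 \<Longrightarrow> odd (count_list (map (\<lambda>i. negative S (face i)) [0..<k]) True) \<longleftrightarrow>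
    (negative S (rim_edge U ` {..<k}) \<noteq> negative S (rim_edge V ` {..<k})) \<noteq>
    ((spoke 0 \<in> S) \<noteq> (spoke k \<in> S))" for k
  proof (induction k)
    case (Suc k)
    then show ?case
      by (auto simp: negative_face negative_path_Suc)
  qed simp
  from this[of 6] have "odd (count_list (map (\<lambda>i. negative S (face i)) [0..<6]) True) \<longleftrightarrow>
    (negative S (rim_edge U ` {..<6}) \<noteq> negative S (rim_edge V ` {..<6})) \<noteq>
    ((spoke 0 \<in> S) \<noteq> (spoke 6 \<in> S))"
    by simp
  moreover have "[0..<7] = [0..<6] @ [6]"
    using upt_Suc[of 0 6] by simp
  then have "odd (count_list (face_signs S) True) \<longleftrightarrow>
    odd (count_list (map (\<lambda>i. negative S (face i)) [0..<6]) True) \<noteq> negative S (face 6)"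
    by (simp add: face_signs_def)
  moreover have "negative S (face 6) \<longleftrightarrow> ((rim_edge U 6 \<in> S) \<noteq> (rim_edge V 6 \<in> S)) \<noteq>
      ((spoke 6 \<in> S) \<noteq> (spoke 0 \<in> S))"
    using negative_face[of 6 S] by simp
  moreover have "negative S (rim X) \<longleftrightarrow> (rim_edge X 6 \<in> S) \<noteq> negative S (rim_edge X ` {..<6})"
    if "X = U \<or> X = V" for X
    unfolding rim_eq_path by (rule negative_path_Suc[OF that]) simp
  ultimately show ?thesis by auto
qed

text \<open>Faces and outer rim span the cycle space, so the difference of \<open>S\<close> and
  \<open>T\<close> meets every cycle evenly and is a cut. The proof constructs one side of
  it.\<close>

lemma switching_equivalent_prismI:
  assumes S: "S \<subseteq> edges prism" and T: "T \<subseteq> edges prism"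
    and faces: "\<And>i. i < 7 \<Longrightarrow> negative S (face i) \<longleftrightarrow> negative T (face i)"
    and rim: "negative S (rim U) \<longleftrightarrow> negative T (rim U)"
  shows "switching_equivalent prism S T"
proof -
  define D where "D = sym_diff S T"
  \<comment> \<open>A vertex is resigned iff the path to it from \<open>U 0\<close> along the outer rim, and possibly a
    spoke, meets \<open>D\<close> in an odd number of edges.\<close>
  define X where "X = {U i |i. i < 7 \<and> negative D (rim_edge U ` {..<i})} \<union>
    {V i |i. i < 7 \<and> negative D (rim_edge U ` {..<i}) \<noteq> (spoke i \<in> D)}"
  have U: "U i \<in> X \<longleftrightarrow> negative D (rim_edge U ` {..<i})" if "i < 7" for i
    using that by (simp add: X_def)
  have V: "V i \<in> X \<longleftrightarrow> negative D (rim_edge U ` {..<i}) \<noteq> (spoke i \<in> D)" if "i < 7" for i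
    using that by (simp add: X_def)
  have "\<not> negative D (rim U)"
    using rim by (simp add: D_def negative_sym_diff finite_rim)
  \<comment> \<open>For \<open>i = 6\<close> the left side refers to the empty path at
    \<open>U 0\<close>; evenness of \<open>D\<close> on the rim makes the relation hold there
    too.\<close>
  then have step: "negative D (rim_edge U ` {..<Suc i mod 7}) \<longleftrightarrow>
      (rim_edge U i \<in> D) \<noteq> negative D (rim_edge U ` {..<i})" if "i < 7" for i
    using that negative_path_Suc[of U i D] by (cases "i = 6") (auto simp: rim_eq_path)
  \<comment> \<open>Evenness on a face transfers the relation along the outer rim to the inner
    rim.\<close>
  have face: "(rim_edge U i \<in> D) \<noteq> (rim_edge V i \<in> D) \<longleftrightarrow>
      (spoke i \<in> D) \<noteq> (spoke (Suc i mod 7) \<in> D)" if "i < 7" for i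
    using faces[OF that] negative_face[OF that, of D]
    by (auto simp: D_def negative_sym_diff finite_face)
  have D: "{x, y} \<in> D \<longleftrightarrow> (x \<in> X) \<noteq> (y \<in> X)" if e: "{x, y} \<in> edges prism" for x y
  proof -
    obtain i where i: "i < 7"
      and c: "{x, y} = rim_edge U i \<or> {x, y} = rim_edge V i \<or> {x, y} = spoke i"
      using e by (auto simp: edges_prism)
    have m: "Suc i mod 7 < 7" by simp
    have "rim_edge U i \<in> D \<longleftrightarrow> (U i \<in> X) \<noteq> (U (Suc i mod 7) \<in> X)"
      using step[OF i] by (auto simp: U[OF i] U[OF m])
    moreover have "rim_edge V i \<in> D \<longleftrightarrow> (V i \<in> X) \<noteq> (V (Suc i mod 7) \<in> X)"
      using step[OF i] face[OF i] by (auto simp: V[OF i] V[OF m])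
    moreover have "spoke i \<in> D \<longleftrightarrow> (U i \<in> X) \<noteq> (V i \<in> X)"
      by (auto simp: U[OF i] V[OF i])
    ultimately show ?thesis
      using c unfolding rim_edge_def spoke_def doubleton_eq_iff
      by (auto simp: insert_commute)
  qed
  have "X \<subseteq> verts prism" by (auto simp: X_def verts_prism)
  moreover from this have "finite X"
    by (rule finite_subset) (simp add: verts_prism)
  ultimately show ?thesis
    using switching_equivalent_cut[OF simple_graph_prism _ _ S T] D
    by (auto simp: D_def)
qed

section \<open>Automorphisms of the prism\<close>

text \<open>Commuting with this involution is how preservation of spokes is expressed.\<close>

definition other :: "pvertex \<Rightarrow> pvertex" where
  "other v = (case v of U i \<Rightarrow> V i | V i \<Rightarrow> U i)"

text \<open>A rim edge lies on only one 4-cycle.\<close>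

lemma rim_edge_4_cycle:
  assumes e: "{x, y} \<in> edges prism" "{y, z} \<in> edges prism" "{z, w} \<in> edges prism"
      "{w, x} \<in> edges prism"
    and ne: "x \<noteq> z" "y \<noteq> w" "y \<noteq> other x"
  shows "w = other x"
proof -
  \<comment> \<open>No 4-cycle stays on one rim: the distinctness conditions forbid turning back, so
    all steps have the same sign and add up to 4 or -4, which is nonzero modulo 7.\<close>
  have *: "False" if "i < 7" "j < 7" "k < 7" "l < 7" "i \<noteq> k" "j \<noteq> l"
    "j = Suc i mod 7 \<or> i = Suc j mod 7" "k = Suc j mod 7 \<or> j = Suc k mod 7"
    "l = Suc k mod 7 \<or> k = Suc l mod 7" "i = Suc l mod 7 \<or> l = Suc i mod 7" for i j k l :: nat
  proof -
    have "j = Suc i mod 7 \<or> j = (i + 6) mod 7" "k = Suc j mod 7 \<or> k = (j + 6) mod 7"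
        "l = Suc k mod 7 \<or> l = (k + 6) mod 7" "l = (i + 6) mod 7 \<or> l = Suc i mod 7"
      using that by (simp_all only: eq_Suc_mod_7_iff)
    then show ?thesis
      using less_7_cases[OF that(1)] that(5,6) by (elim disjE) simp_all
  qed
  show ?thesis
    using e ne
    by (cases x; cases y; cases z; cases w)
      (simp_all add: adjacent_prism other_def, (use * Suc_mod_7_neq in metis)+)
qed

text \<open>A rim edge, its copy on the other rim and the two spokes between them bound a
  face.\<close>

lemma prism_other:
  assumes "{v, w} \<in> edges prism" "w \<noteq> other v"
  shows "{v, other v} \<in> edges prism" "{other v, other w} \<in> edges prism"
    "{other w, w} \<in> edges prism"
  using assms by (cases v; cases w; auto simp: adjacent_prism other_def)+

lemma edge_in_verts:
  assumes "{v, w} \<in> edges prism"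
  shows "v \<in> verts prism" "w \<in> verts prism"
  using assms simple_graph_prism by (auto simp: simple_graph_def)

text \<open>If the spoke at \<open>v\<close> went to a rim edge, the two faces through this spoke
  would go to 4-cycles through that rim edge. By \<open>rim_edge_4_cycle\<close> both rim neighbours
  of \<open>v\<close> would then have the image \<open>other (\<psi> v)\<close>, against
  injectivity.\<close>

lemma automorphism_other:
  assumes \<psi>: "automorphism prism \<psi>" and v: "v \<in> verts prism"
  shows "\<psi> (other v) = other (\<psi> v)"
proof (rule ccontr)
  assume *: "\<psi> (other v) \<noteq> other (\<psi> v)"
  have inj: "inj_on \<psi> (verts prism)"
    using automorphism_bij[OF \<psi>] by (simp add: bij_betw_def)
  have nbr: "\<psi> w = other (\<psi> v)" if w: "{v, w} \<in> edges prism" "w \<noteq> other v" for w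
  proof (rule rim_edge_4_cycle)
    note e = prism_other[OF w]
    have img: "{\<psi> x, \<psi> y} \<in> edges prism" if "{x, y} \<in> edges prism" for x y
      using that edge_in_verts[OF that] automorphism_edge[OF \<psi>] by blast
    show "{\<psi> v, \<psi> (other v)} \<in> edges prism" "{\<psi> (other v), \<psi> (other w)} \<in> edges prism"
      "{\<psi> (other w), \<psi> w} \<in> edges prism" "{\<psi> w, \<psi> v} \<in> edges prism"
      using e w(1) by (simp_all add: img insert_commute)
    have "v \<noteq> other w" "other v \<noteq> w"
      using w(2) by (auto simp: other_def split: pvertex.splits)
    then show "\<psi> v \<noteq> \<psi> (other w)" "\<psi> (other v) \<noteq> \<psi> w"
      using edge_in_verts[OF w(1)] edge_in_verts[OF e(2)] inj_onD[OF inj] by metis+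
  qed (rule *)
  obtain X i where i: "i < 7" "v = X i" and X: "X = U \<or> X = V"
    using v by (auto simp: verts_prism)
  let ?p = "X (Suc i mod 7)" and ?q = "X ((i + 6) mod 7)"
  have "i = Suc ((i + 6) mod 7) mod 7" using i(1) by (simp add: eq_Suc_mod_7_iff)
  then have e: "{v, ?p} \<in> edges prism" "{v, ?q} \<in> edges prism"
    using i X by (auto simp: adjacent_prism)
  have "?p \<noteq> other v" "?q \<noteq> other v" using i(2) X by (auto simp: other_def)
  then have "\<psi> ?p = \<psi> ?q" using nbr e by metis
  then have "?p = ?q" using inj edge_in_verts e by (metis inj_onD)
  moreover have "Suc i mod 7 \<noteq> (i + 6) mod 7"
    using less_7_cases[OF i(1)] by (elim disjE) simp_all
  ultimately show False using X by auto
qed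

text \<open>
  A reflection sends vertex \<open>i\<close> to \<open>b - i\<close>, hence face \<open>i\<close>, which lies between vertices \<open>i\<close>
  and \<open>i + 1\<close>, to face \<open>b - i - 1\<close>.
\<close>

definition turn :: "bool \<Rightarrow> nat \<Rightarrow> nat \<Rightarrow> nat" where
  "turn r b i = (b + (if r then 7 - i else i)) mod 7"

definition face_turn :: "bool \<Rightarrow> nat \<Rightarrow> nat \<Rightarrow> nat" where
  "face_turn r b i = (b + (if r then 6 - i else i)) mod 7"

section \<open>Arithmetic of rotations and reflections modulo 7\<close>

lemma turn_less [simp]: "turn r b i < 7" "face_turn r b i < 7"
  by (simp_all add: turn_def face_turn_def)

lemma add_mod_7_cancel:
  fixes b :: nat
  assumes "b < 7"
  shows "(b + i) mod 7 = (b + j) mod 7 \<longleftrightarrow> i mod 7 = j mod 7"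
proof
  \<comment> \<open>Adding \<open>7 - b\<close> undoes the rotation by \<open>b\<close>.\<close>
  have *: "((b + k) mod 7 + (7 - b)) mod 7 = k mod 7" for k
  proof -
    have "((b + k) mod 7 + (7 - b)) mod 7 = (b + k + (7 - b)) mod 7" by (rule mod_add_left_eq)
    also have "b + k + (7 - b) = k + 7" using assms by simp
    finally show ?thesis by simp
  qed
  show "i mod 7 = j mod 7" if "(b + i) mod 7 = (b + j) mod 7"
    using *[of i] *[of j] that by metis
qed (metis mod_add_right_eq)

lemma turn_eq_iff:
  assumes "i < 7" "j < 7" "b < 7"
  shows "turn r b i = turn r b j \<longleftrightarrow> i = j" "face_turn r b i = face_turn r b j \<longleftrightarrow> i = j"
proof -
  have "(7 - i) mod 7 = (7 - j) mod 7 \<longleftrightarrow> i = j"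
    using less_7_cases[OF assms(1)] less_7_cases[OF assms(2)] by (elim disjE) simp_all
  then show "turn r b i = turn r b j \<longleftrightarrow> i = j" "face_turn r b i = face_turn r b j \<longleftrightarrow> i = j"
    using assms by (auto simp: turn_def face_turn_def add_mod_7_cancel)
qed

text \<open>Rotations keep the cyclic direction and reflections reverse it.\<close>

lemma turn_adjacent:
  assumes "i < 7" "j < 7" "b < 7"
  shows "turn r b j = Suc (turn r b i) mod 7 \<longleftrightarrow>
    (if r then i = Suc j mod 7 else j = Suc i mod 7)"
proof -
  have "Suc ((b + k) mod 7) mod 7 = (b + Suc k) mod 7" for k
    by (simp add: mod_Suc_eq)
  moreover have "(7 - j) mod 7 = Suc (7 - i) mod 7 \<longleftrightarrow> i = Suc j mod 7"
    using less_7_cases[OF assms(1)] less_7_cases[OF assms(2)] by (elim disjE) simp_all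
  ultimately show ?thesis
    using assms(2) by (simp only: turn_def add_mod_7_cancel[OF assms(3)]) simp
qed

text \<open>The pairs are unordered because a reflection swaps the two ends; its lower end is then
  the image of \<open>i + 1\<close>.\<close>

lemma turn_face_turn:
  assumes "i < 7"
  shows "{turn r b i, turn r b (Suc i mod 7)} = {face_turn r b i, Suc (face_turn r b i) mod 7}"
  using less_7_cases[OF assms]
  by (elim disjE; simp add: turn_def face_turn_def insert_commute mod_Suc_eq add.commute)

lemma image_face_turn:
  assumes "b < 7"
  shows "face_turn r b ` {..<7} = {..<7}"
  using assms by (intro endo_inj_surj) (auto simp: inj_on_def turn_eq_iff)

text \<open>The dihedral group of order 14 combined with the exchange of the rims. Index 0 goes to
  \<open>b\<close>, and \<open>X\<close> is the rim onto which the outer rim is mapped; only values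
  on vertices are fixed.\<close>

definition turns ::
  "bool \<Rightarrow> nat \<Rightarrow> (nat \<Rightarrow> pvertex) \<Rightarrow> (nat \<Rightarrow> pvertex) \<Rightarrow> (pvertex \<Rightarrow> pvertex) \<Rightarrow> bool" where
  "turns r b X Y \<psi> \<longleftrightarrow> b < 7 \<and> (X = U \<and> Y = V \<or> X = V \<and> Y = U) \<and>
    (\<forall>i<7. \<psi> (U i) = X (turn r b i) \<and> \<psi> (V i) = Y (turn r b i))"

text \<open>The image of \<open>U 0\<close> determines \<open>X\<close> and \<open>b\<close>, and
  that of \<open>U 1\<close> determines \<open>r\<close>. Injectivity forces the rest of the rim,
  and preservation of spokes then gives the other rim.\<close>

lemma automorphism_turns:
  assumes \<psi>: "automorphism prism \<psi>"
  obtains r b X Y where "turns r b X Y \<psi>"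
proof -
  have inj: "inj_on \<psi> (verts prism)"
    using automorphism_bij[OF \<psi>] by (simp add: bij_betw_def)
  have v: "U i \<in> verts prism" "V i \<in> verts prism" if "i < 7" for i
    using that by (auto simp: verts_prism)
  have "\<psi> (U 0) \<in> verts prism" using \<psi> by (simp add: automorphism_vert v)
  then obtain X Y b where b: "b < 7" "\<psi> (U 0) = X b" and XY: "X = U \<and> Y = V \<or> X = V \<and> Y = U"
    by (auto simp: verts_prism)
  \<comment> \<open>Spokes go to spokes, so the image of a rim edge is again a rim edge, and the
    walk stays on the rim \<open>X\<close>.\<close>
  have step: "\<psi> (U (Suc i)) = X (Suc j mod 7) \<or> \<psi> (U (Suc i)) = X ((j + 6) mod 7)"
    if i: "i < 6" and j: "\<psi> (U i) = X j" for i j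
  proof -
    have "{U i, U (Suc i)} \<in> edges prism" using i by (simp add: adjacent_prism)
    then have e: "{X j, \<psi> (U (Suc i))} \<in> edges prism"
      using automorphism_edge[OF \<psi>, of "U i" "U (Suc i)"] i j by (simp add: v)
    have "\<psi> (U (Suc i)) \<noteq> \<psi> (V i)"
      using inj_onD[OF inj, of "U (Suc i)" "V i"] i by (auto simp: v)
    then have "\<psi> (U (Suc i)) \<noteq> other (X j)"
      using automorphism_other[OF \<psi>, of "U i"] i j by (simp add: v) (simp add: other_def)
    then obtain k where "\<psi> (U (Suc i)) = X k" "j < 7" "k < 7" "k = Suc j mod 7 \<or> j = Suc k mod 7"
      using e XY by (cases "\<psi> (U (Suc i))") (auto simp: adjacent_prism other_def)
    then show ?thesis using eq_Suc_mod_7_iff[of j k] by auto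
  qed
  have "turn False b 1 = Suc b mod 7" "turn True b 1 = (b + 6) mod 7"
    by (simp_all add: turn_def add.commute)
  moreover have "\<psi> (U 1) = X (Suc b mod 7) \<or> \<psi> (U 1) = X ((b + 6) mod 7)"
    using step[OF _ b(2)] by simp
  ultimately have "\<exists>r. \<psi> (U 1) = X (turn r b 1)" by metis
  then obtain r where r: "\<psi> (U 1) = X (turn r b 1)" by blast
  \<comment> \<open>Two consecutive values are carried along, since the earlier one excludes turning
    back.\<close>
  have "i < 6 \<longrightarrow> \<psi> (U i) = X (turn r b i) \<and> \<psi> (U (Suc i)) = X (turn r b (Suc i))" for i
  proof (induction i)
    case 0
    then show ?case using b r by (simp add: turn_def)
  next
    case (Suc i)
    show ?case
    proof
      assume i: "Suc i < 6"
      then have IH: "\<psi> (U i) = X (turn r b i)" "\<psi> (U (Suc i)) = X (turn r b (Suc i))"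
        using Suc by auto
      let ?j = "turn r b (Suc i)" and ?k = "turn r b (Suc (Suc i))"
      have "\<psi> (U (Suc (Suc i))) \<noteq> X (turn r b i)"
        using inj_onD[OF inj, of "U (Suc (Suc i))" "U i"] i IH(1) by (auto simp: v)
      moreover have "?k = Suc ?j mod 7 \<and> turn r b i = (?j + 6) mod 7 \<or>
        ?k = (?j + 6) mod 7 \<and> turn r b i = Suc ?j mod 7"
        using turn_adjacent[of i "Suc i" b r] turn_adjacent[of "Suc i" i b r]
          turn_adjacent[of "Suc i" "Suc (Suc i)" b r] turn_adjacent[of "Suc (Suc i)" "Suc i" b r]
          eq_Suc_mod_7_iff[of ?j ?k] eq_Suc_mod_7_iff[of ?j "turn r b i"] i b(1)
        by (auto split: if_splits)
      ultimately have "\<psi> (U (Suc (Suc i))) = X ?k"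
        using step[OF i IH(2)] by auto
      then show "\<psi> (U (Suc i)) = X ?j \<and> \<psi> (U (Suc (Suc i))) = X ?k"
        using IH(2) by simp
    qed
  qed
  \<comment> \<open>The last vertex, \<open>i = 6\<close>, is the second component of the claim for
    5.\<close>
  from this this[of 5] have U: "\<psi> (U i) = X (turn r b i)" if "i < 7" for i
    using that by (cases "i = 6") auto
  moreover have "\<psi> (V i) = Y (turn r b i)" if "i < 7" for i
    using automorphism_other[OF \<psi> v(1)[OF that]] U[OF that] XY by (auto simp: other_def)
  ultimately have "turns r b X Y \<psi>" using b(1) XY by (simp add: turns_def)
  then show thesis by (rule that)
qed

lemma turns_automorphism:
  assumes "turns r b X Y \<psi>"
  shows "automorphism prism \<psi>"
proof -
  have b: "b < 7" and XY: "X = U \<and> Y = V \<or> X = V \<and> Y = U"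
    and \<psi>: "\<And>i. i < 7 \<Longrightarrow> \<psi> (U i) = X (turn r b i)" "\<And>i. i < 7 \<Longrightarrow> \<psi> (V i) = Y (turn r b i)"
    using assms by (auto simp: turns_def)
  have "inj_on \<psi> (verts prism)"
    using XY by (auto simp: inj_on_def verts_prism \<psi> turn_eq_iff b)
  moreover have "\<psi> ` verts prism \<subseteq> verts prism"
    using XY by (auto simp: verts_prism \<psi>)
  moreover have "finite (verts prism)" by (simp add: verts_prism)
  ultimately have "bij_betw \<psi> (verts prism) (verts prism)"
    by (simp add: bij_betw_def endo_inj_surj)
  moreover have "{x, y} \<in> edges prism \<longleftrightarrow> {\<psi> x, \<psi> y} \<in> edges prism"
    if "x \<in> verts prism" "y \<in> verts prism" for x y
    using that XY unfolding verts_prism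
    by (elim UnE imageE disjE conjE; simp add: \<psi> adjacent_prism turn_adjacent turn_eq_iff b)
      (auto)
  ultimately show ?thesis by (simp add: automorphism_def)
qed

text \<open>Exchanging the rims fixes every face as a set of edges, so \<open>X\<close> and
  \<open>Y\<close> affect only the image of the rim.\<close>

lemma turns_image:
  assumes "turns r b X Y \<psi>"
  shows "i < 7 \<Longrightarrow> (`) \<psi> ` face i = face (face_turn r b i)"
    and "(`) \<psi> ` rim U = rim X"
proof -
  have b: "b < 7" and XY: "X = U \<and> Y = V \<or> X = V \<and> Y = U"
    and \<psi>: "\<And>i. i < 7 \<Longrightarrow> \<psi> (U i) = X (turn r b i)" "\<And>i. i < 7 \<Longrightarrow> \<psi> (V i) = Y (turn r b i)"
    using assms by (auto simp: turns_def)
  have edge: "\<psi> ` rim_edge U i = rim_edge X (face_turn r b i)"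
    "\<psi> ` rim_edge V i = rim_edge Y (face_turn r b i)" if "i < 7" for i
    using arg_cong[OF turn_face_turn[OF that, of r b], of "image X"]
      arg_cong[OF turn_face_turn[OF that, of r b], of "image Y"] that
    by (simp_all add: rim_edge_def \<psi>)
  have spoke: "\<psi> ` spoke i = spoke (turn r b i)" if "i < 7" for i
    using XY that by (auto simp: spoke_def \<psi>)
  show "(`) \<psi> ` face i = face (face_turn r b i)" if "i < 7" for i
  proof -
    have "{spoke (turn r b i), spoke (turn r b (Suc i mod 7))} =
        {spoke (face_turn r b i), spoke (Suc (face_turn r b i) mod 7)}"
      using arg_cong[OF turn_face_turn[OF that, of r b], of "image spoke"] by simp
    then show ?thesis
      using XY that by (auto simp: face_def edge spoke)
  qed
  have "(`) \<psi> ` rim U = rim_edge X ` face_turn r b ` {..<7}"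
    unfolding rim_def image_image by (rule image_cong) (simp_all add: edge)
  then show "(`) \<psi> ` rim U = rim X"
    by (simp add: image_face_turn b rim_def)
qed

section \<open>The classification\<close>

text \<open>A list, possibly with repetitions, makes membership in an orbit decidable by
  evaluation.\<close>

definition dihedral_orbit :: "bool list \<Rightarrow> bool list list" where
  "dihedral_orbit cs =
    map (\<lambda>b. rotate b cs) [0..<7] @ map (\<lambda>b. rev (rotate b cs)) [0..<7]"

text \<open>Reversal replaces index \<open>i\<close> by \<open>6 - i\<close>, which is the
  reflection in \<open>face_turn\<close>.\<close>

lemma in_dihedral_orbit_iff:
  assumes "length bs = 7" "length cs = 7"
  shows "bs \<in> set (dihedral_orbit cs) \<longleftrightarrow>
    (\<exists>r b. b < 7 \<and> (\<forall>i<7. bs ! i = cs ! face_turn r b i))"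
proof -
  have "bs = (if r then rev (rotate b cs) else rotate b cs) \<longleftrightarrow>
      (\<forall>i<7. bs ! i = cs ! face_turn r b i)" for r b
    using assms by (auto simp: list_eq_iff_nth_eq nth_rotate rev_nth face_turn_def)
  then have "(\<exists>r b. b < 7 \<and> (\<forall>i<7. bs ! i = cs ! face_turn r b i)) \<longleftrightarrow>
      (\<exists>r. \<exists>b<7. bs = (if r then rev (rotate b cs) else rotate b cs))"
    by simp
  then show ?thesis
    by (auto simp: dihedral_orbit_def ex_bool_eq)
qed

text \<open>Automorphisms act on the face signs as the dihedral group, and independently may
  exchange the rims. By \<open>negative_rim_V\<close> the rim signs differ exactly for odd weight,
  so only then does the exchange change the outer sign.\<close>

lemma switching_isomorphism_prism_iff:
  "(S, T) \<in> switching_isomorphism_rel prism \<longleftrightarrow> S \<subseteq> edges prism \<and> T \<subseteq> edges prism \<and>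
    face_signs S \<in> set (dihedral_orbit (face_signs T)) \<and>
    ((negative S (rim U) \<longleftrightarrow> negative T (rim U)) \<or> odd (count_list (face_signs T) True))"
    (is "?L \<longleftrightarrow> ?R")
proof
  assume ?L
  then obtain \<psi> where S: "S \<subseteq> edges prism" and T: "T \<subseteq> edges prism" and \<psi>: "automorphism prism \<psi>"
    and sw: "switching_equivalent prism ((`) \<psi> ` S) T"
    by (auto simp: switching_isomorphism_rel_def switching_isomorphic_def signatures_def)
  from \<psi> obtain r b X Y where t: "turns r b X Y \<psi>" by (rule automorphism_turns)
  then have X: "X = U \<or> X = V" and b: "b < 7" by (auto simp: turns_def)
  have "negative T (face (face_turn r b i)) \<longleftrightarrow> negative S (face i)" if "i < 7" for i
    using negative_image[OF simple_graph_prism \<psi> S face_subset[OF that]]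
    by (simp add: turns_image(1)[OF t that] face_rim_switching_equivalent(1)[OF sw])
  then have "face_signs S \<in> set (dihedral_orbit (face_signs T))"
    using b by (auto simp: in_dihedral_orbit_iff)
  moreover have "negative T (rim X) \<longleftrightarrow> negative S (rim U)"
    using negative_image[OF simple_graph_prism \<psi> S rim_subset[of U]]
    by (simp add: turns_image(2)[OF t] face_rim_switching_equivalent(2)[OF sw X])
  ultimately show ?R
    using S T X negative_rim_V[of T] by auto
next
  assume R: ?R
  then obtain r b where S: "S \<subseteq> edges prism" and T: "T \<subseteq> edges prism" and b: "b < 7"
    and faces: "\<And>i. i < 7 \<Longrightarrow> negative S (face i) \<longleftrightarrow> negative T (face (face_turn r b i))"
    by (auto simp: in_dihedral_orbit_iff)
  \<comment> \<open>The rims are exchanged exactly when the outer signs disagree, which the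
    assumption permits only for odd weight.\<close>
  define X Y where "X = (if negative S (rim U) \<longleftrightarrow> negative T (rim U) then U else V)"
    and "Y = (if negative S (rim U) \<longleftrightarrow> negative T (rim U) then V else U)"
  define \<psi> where "\<psi> v = (case v of U i \<Rightarrow> X (turn r b i) | V i \<Rightarrow> Y (turn r b i))" for v
  have t: "turns r b X Y \<psi>"
    using b by (simp add: turns_def \<psi>_def X_def Y_def)
  then have \<psi>: "automorphism prism \<psi>" by (rule turns_automorphism)
  let ?S = "(`) \<psi> ` S"
  have sub: "?S \<subseteq> edges prism"
    using automorphism_image_edge[OF simple_graph_prism \<psi>] S by auto
  have faces': "negative ?S (face j) \<longleftrightarrow> negative T (face j)" if j: "j < 7" for j
  proof -
    obtain i where i: "i < 7" "j = face_turn r b i"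
      using image_face_turn[OF b, of r] j by (metis imageE lessThan_iff)
    then show ?thesis
      using negative_image[OF simple_graph_prism \<psi> S face_subset[OF i(1)]] faces[OF i(1)]
      by (simp add: turns_image(1)[OF t i(1)])
  qed
  have "negative ?S (rim U) \<longleftrightarrow> negative T (rim U)"
  proof -
    have "face_signs ?S = face_signs T"
      using faces' by (simp add: face_signs_def)
    moreover have "negative ?S (rim X) \<longleftrightarrow> negative S (rim U)"
      using negative_image[OF simple_graph_prism \<psi> S rim_subset[of U]]
      by (simp add: turns_image(2)[OF t])
    ultimately show ?thesis
      using R negative_rim_V[of ?S] by (auto simp: X_def split: if_splits)
  qed
  then have "switching_equivalent prism ?S T"
    using switching_equivalent_prismI[OF sub T] faces' by blast
  then show ?L
    using S T \<psi> by (auto simp: switching_isomorphism_rel_def switching_isomorphic_def signatures_def)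
qed

text \<open>The inner rim carries the face signs and one outer edge carries the rim sign
  \<open>h\<close>. That edge lies on face 6, so the inner edge of face 6 is flipped to
  compensate.\<close>

definition signature_of :: "bool list \<Rightarrow> bool \<Rightarrow> pvertex set set" where
  "signature_of bs h = rim_edge V ` {i. i < 7 \<and> bs ! i \<noteq> (h \<and> i = 6)} \<union>
    (if h then {rim_edge U 6} else {})"

lemma signature_of_subset: "signature_of bs h \<subseteq> edges prism"
  by (auto simp: signature_of_def edges_prism)

lemma face_signs_signature_of:
  assumes "length bs = 7"
  shows "face_signs (signature_of bs h) = bs"
proof (rule nth_equalityI)
  fix i assume "i < length (face_signs (signature_of bs h))"
  then have i: "i < 7" by simp
  have "rim_edge V i \<in> signature_of bs h \<longleftrightarrow> bs ! i \<noteq> (h \<and> i = 6)"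
    "rim_edge U i \<in> signature_of bs h \<longleftrightarrow> h \<and> i = 6"
    "spoke j \<notin> signature_of bs h" for j
    using i by (auto simp: signature_of_def rim_edge_inject)
  then show "face_signs (signature_of bs h) ! i = bs ! i"
    by (auto simp: i negative_face)
qed (simp add: assms)

lemma negative_rim_signature_of: "negative (signature_of bs h) (rim U) \<longleftrightarrow> h"
proof -
  have "rim_edge U 6 \<in> rim U" unfolding rim_def by (rule imageI) simp
  moreover have "rim_edge V i \<notin> rim U" for i by (auto simp: rim_def)
  ultimately have "signature_of bs h \<inter> rim U = (if h then {rim_edge U 6} else {})"
    unfolding signature_of_def by auto
  then show ?thesis by (simp add: negative_def)
qed

text \<open>The first nine words have at most three negative faces; the last nine are their
  complements.\<close>

definition bracelets :: "bool list list" where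
  "bracelets = [
    [False, False, False, False, False, False, False],
    [True, False, False, False, False, False, False],
    [True, True, False, False, False, False, False],
    [True, False, True, False, False, False, False],
    [True, False, False, True, False, False, False],
    [True, True, True, False, False, False, False],
    [True, True, False, True, False, False, False],
    [True, False, True, False, True, False, False],
    [True, True, False, False, True, False, False],
    [False, False, False, True, True, True, True],
    [False, False, True, False, True, True, True],
    [False, True, False, True, False, True, True],
    [False, False, True, True, False, True, True],
    [False, False, True, True, True, True, True],
    [False, True, False, True, True, True, True],
    [False, True, True, False, True, True, True],
    [False, True, True, True, True, True, True],
    [True, True, True, True, True, True, True]]"

text \<open>
  Since \<open>switching_isomorphism_prism_iff\<close> ignores the rim when the number of negative faces
  is odd, such a bracelet yields one class and every other bracelet two.
\<close>

definition representatives :: "(bool list \<times> bool) list" where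
  "representatives = [(cs, h). cs \<leftarrow> bracelets,
    h \<leftarrow> (if odd (count_list cs True) then [False] else [False, True])]"

lemma bracelets_cover:
  assumes "length bs = 7"
  shows "\<exists>cs\<in>set bracelets. bs \<in> set (dihedral_orbit cs)"
proof -
  \<comment> \<open>All 128 sign words are checked by evaluation.\<close>
  have "\<forall>bs\<in>set (List.n_lists 7 [False, True]). \<exists>cs\<in>set bracelets. bs \<in> set (dihedral_orbit cs)"
    by code_simp
  moreover have "bs \<in> set (List.n_lists 7 [False, True])"
    using assms by (auto simp: set_n_lists)
  ultimately show ?thesis by blast
qed

text \<open>With \<open>bracelets_cover\<close>, this makes the list a transversal of the dihedral
  orbits.\<close>

lemma bracelets_inequivalent:
  "\<forall>bs\<in>set bracelets. \<forall>cs\<in>set bracelets. bs \<in> set (dihedral_orbit cs) \<longrightarrow> bs = cs"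
  by code_simp

lemma length_bracelets: "\<forall>bs\<in>set bracelets. length bs = 7"
  by code_simp

section \<open>Counting the classes\<close>

lemma card_representatives: "card (set representatives) = 27"
proof -
  have "distinct representatives \<and> length representatives = 27" by code_simp
  then show ?thesis using distinct_card by metis
qed

lemma in_representatives_iff:
  "(cs, h) \<in> set representatives \<longleftrightarrow> cs \<in> set bracelets \<and> (h \<longrightarrow> even (count_list cs True))"
  by (auto simp: representatives_def)

theorem theorem9:
  shows "card (signatures (petersen 7 1) // switching_isomorphism_rel (petersen 7 1)) = 27"
proof -
  let ?R = "switching_isomorphism_rel prism"
  define sig where "sig = case_prod signature_of"
  note equiv = equiv_switching_isomorphism_rel[OF simple_graph_prism]
  have sub: "sig p \<in> signatures prism" for p
    by (cases p) (simp add: sig_def signatures_def signature_of_subset)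
  have "inj_on (\<lambda>p. ?R `` {sig p}) (set representatives)"
  proof (rule inj_onI)
    fix p q assume p: "p \<in> set representatives" and q: "q \<in> set representatives"
      and "?R `` {sig p} = ?R `` {sig q}"
    then have "(sig p, sig q) \<in> ?R" using equiv sub by (metis eq_equiv_class)
    moreover obtain bs h cs k where pq: "p = (bs, h)" "q = (cs, k)" by (cases p, cases q)
    moreover have bs: "bs \<in> set bracelets" "cs \<in> set bracelets"
      using p q pq by (auto simp: in_representatives_iff)
    ultimately have "bs \<in> set (dihedral_orbit cs)" "h = k \<or> odd (count_list cs True)"
      using length_bracelets
      by (auto simp: switching_isomorphism_prism_iff sig_def face_signs_signature_of
          negative_rim_signature_of)
    moreover from this have "bs = cs" using bs bracelets_inequivalent by blast
    \<comment> \<open>For odd weight both rim flags are \<open>False\<close> by the choice of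
      representatives.\<close>
    ultimately show "p = q" using p q by (auto simp: pq in_representatives_iff)
  qed
  moreover have "signatures prism // ?R = (\<lambda>p. ?R `` {sig p}) ` set representatives"
  proof (intro equalityI subsetI)
    fix A assume "A \<in> signatures prism // ?R"
    then obtain S where S: "S \<subseteq> edges prism" "A = ?R `` {S}"
      by (auto simp: quotient_def signatures_def)
    obtain cs where cs: "cs \<in> set bracelets" "face_signs S \<in> set (dihedral_orbit cs)"
      using bracelets_cover[of "face_signs S"] by auto
    \<comment> \<open>For odd weight the flag defaults to \<open>False\<close>; the rim sign of
      \<open>S\<close> is then irrelevant to its class.\<close>
    define p where "p = (cs, even (count_list cs True) \<and> negative S (rim U))"
    have "(S, sig p) \<in> ?R"
      using S(1) cs length_bracelets
      by (auto simp: switching_isomorphism_prism_iff p_def sig_def signature_of_subset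
          face_signs_signature_of negative_rim_signature_of)
    then have "A = ?R `` {sig p}" using S(2) equiv equiv_class_eq by metis
    moreover have "p \<in> set representatives"
      using cs(1) by (simp add: p_def in_representatives_iff)
    ultimately show "A \<in> (\<lambda>p. ?R `` {sig p}) ` set representatives" by blast
  next
    fix A assume "A \<in> (\<lambda>p. ?R `` {sig p}) ` set representatives"
    then show "A \<in> signatures prism // ?R" using sub by (auto intro: quotientI)
  qed
  ultimately have "card (signatures prism // ?R) = 27"
    by (simp add: card_image card_representatives)
  then show ?thesis by (simp only: prism_def)
qed

end
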